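(* Let $n\geq 3$ be an integer and let $f:\{0,1\}^n\to\{0,1\}^n$ be the vector-valued Boolean function whose $i$-th output, for $i\in\{1,\dots,n\}$, is \[ f_i(x_1,\dots,x_n)=\bigwedge_{j\in\{1,\dots,n\}\setminus\{i\}} x_j . \] Then the multiplicative complexity of $f$ is exactly $c_\land(f)=2n-3$.
   Context: The multiplicative complexity $c_\land(f)$ of a (possibly vector-valued) Boolean function $f$ is the smallest number of AND gates (each with two Boolean inputs) in any Boolean circuit computing all outputs of $f$ that consists only of AND gates with two inputs, XOR gates (exclusive OR of an arbitrary number of inputs), and NOT gates (equivalently, XOR with the constant $1$). *)

theory Defs
  imports Main
begin

text \<open>
  Circuits are straight-line programs. In a circuit with \<open>n\<close> inputs, wires \<open>0, \<dots>, n - 1\<close> carry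
  the inputs and wire \<open>n + k\<close> carries the value of the \<open>k\<close>-th gate (counting from 0); the
  arguments of a gate are the indices of the wires it reads. Any wire may be read by any number
  of later gates and outputs.
\<close>

datatype gate = AndGate nat nat | XorGate "nat list" | NotGate nat

datatype circuit = Circuit (gates: "gate list") (outputs: "nat list")

fun gate_args :: "gate \<Rightarrow> nat set" where
  "gate_args (AndGate a b) = {a, b}"
| "gate_args (XorGate as) = set as"
| "gate_args (NotGate a) = {a}"

fun gate_val :: "bool list \<Rightarrow> gate \<Rightarrow> bool" where
  "gate_val ws (AndGate a b) = (ws ! a \<and> ws ! b)"
| "gate_val ws (XorGate as) = odd (length (filter (\<lambda>a. ws ! a) as))"
| "gate_val ws (NotGate a) = (\<not> ws ! a)"

fun is_and_gate :: "gate \<Rightarrow> bool" where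
  "is_and_gate (AndGate a b) = True"
| "is_and_gate (XorGate as) = False"
| "is_and_gate (NotGate a) = False"

definition wf_circuit :: "nat \<Rightarrow> circuit \<Rightarrow> bool" where
  "wf_circuit n C \<longleftrightarrow>
     (\<forall>k < length (gates C). gate_args (gates C ! k) \<subseteq> {..<n + k}) \<and>
     set (outputs C) \<subseteq> {..<n + length (gates C)}"

definition wire_vals :: "gate list \<Rightarrow> bool list \<Rightarrow> bool list" where
  "wire_vals gs xs = foldl (\<lambda>ws g. ws @ [gate_val ws g]) xs gs"

definition circuit_eval :: "circuit \<Rightarrow> bool list \<Rightarrow> bool list" where
  "circuit_eval C xs = map (\<lambda>a. wire_vals (gates C) xs ! a) (outputs C)"

text \<open>
  A function from \<open>{0,1}\<^sup>n\<close> to \<open>{0,1}\<^sup>m\<close> is represented by a function on Boolean lists; only its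
  values on lists of length \<open>n\<close> matter.
\<close>

definition computes :: "nat \<Rightarrow> circuit \<Rightarrow> (bool list \<Rightarrow> bool list) \<Rightarrow> bool" where
  "computes n C f \<longleftrightarrow> wf_circuit n C \<and> (\<forall>xs. length xs = n \<longrightarrow> circuit_eval C xs = f xs)"

definition and_count :: "circuit \<Rightarrow> nat" where
  "and_count C = length (filter is_and_gate (gates C))"

definition multiplicative_complexity :: "nat \<Rightarrow> (bool list \<Rightarrow> bool list) \<Rightarrow> nat" where
  "multiplicative_complexity n f = (LEAST c. \<exists>C. computes n C f \<and> and_count C = c)"

end

(*
  Lower bound. A function computed with j conjunctions has degree at most j + 1, so the first n - 3
  conjunctions of a circuit have degree at most n - 2. The n outputs are linearly independent modulo
  functions of degree n - 2, hence at least n further conjunctions are needed.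

  Upper bound. For odd m, the function T = "at most one of x_1, ..., x_m is 0" is a product of (m - 1)/2
  majorities of a prefix parity and two further variables, which takes m - 2 conjunctions.
  As f_i + f_j = T (x_i + x_j) and the f_i sum to T, m - 1 further conjunctions give all f_i; this
  settles n = m. For n = m + 1, the same is done with x_n T in place of T, and the remaining output
  x_1 ... x_m is T (x_1 + ... + x_m).
*)

theory Submission
  imports Defs
begin

section \<open>Affine spans of Boolean functions\<close>

text \<open>A point of the cube is the set of its coordinates with value 1.\<close>

type_synonym bool_fun = "nat set \<Rightarrow> bool"

text \<open>On Booleans \<noteq> is XOR, so these are the functions that XOR and NOT gates produce
  from \<open>S\<close> without any conjunction.\<close>

inductive_set aspan :: "('a \<Rightarrow> bool) set \<Rightarrow> ('a \<Rightarrow> bool) set" for S where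
  const: "(\<lambda>_. c) \<in> aspan S"
| base: "f \<in> S \<Longrightarrow> f \<in> aspan S"
| add: "f \<in> aspan S \<Longrightarrow> g \<in> aspan S \<Longrightarrow> (\<lambda>x. f x \<noteq> g x) \<in> aspan S"

lemma aspan_trans:
  assumes "f \<in> aspan S" "S \<subseteq> aspan T"
  shows "f \<in> aspan T"
  using assms
proof (induction rule: aspan.induct)
  case (add f g)
  then show ?case by (intro aspan.add)
qed (auto intro: aspan.const)

lemma aspan_mono: "f \<in> aspan S \<Longrightarrow> S \<subseteq> T \<Longrightarrow> f \<in> aspan T"
  by (erule aspan_trans) (auto intro: aspan.base)

text \<open>Substituting for each generator its representative on \<open>R\<close> commutes with
  XOR. This makes a whole span affine on a part of the cube once its generators are.\<close>

lemma aspan_agrees_on: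
  assumes "f \<in> aspan S" "\<And>g. g \<in> S \<Longrightarrow> \<exists>L \<in> aspan T. \<forall>x. R x \<longrightarrow> g x = L x"
  shows "\<exists>L \<in> aspan T. \<forall>x. R x \<longrightarrow> f x = L x"
  using assms
proof (induction rule: aspan.induct)
  case (add f g)
  then obtain L M where "L \<in> aspan T" "\<forall>x. R x \<longrightarrow> f x = L x"
    "M \<in> aspan T" "\<forall>x. R x \<longrightarrow> g x = M x" by blast
  then show ?case by (intro bexI[OF _ aspan.add[of L _ M]]) auto
qed (auto intro: aspan.const)

lemma aspan_neg: "f \<in> aspan S \<Longrightarrow> (\<lambda>x. \<not> f x) \<in> aspan S"
  using aspan.add[OF _ aspan.const[of True]] by simp

lemma aspan_odd_card:
  assumes "finite I" "\<And>i. i \<in> I \<Longrightarrow> g i \<in> aspan S"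
  shows "(\<lambda>x. odd (card {i \<in> I. g i x})) \<in> aspan S"
  using assms
proof (induction I rule: finite_induct)
  case empty
  show ?case using aspan.const[of False] by simp
next
  case (insert i I)
  have *: "{j \<in> insert i I. g j x} = (if g i x then insert i {j \<in> I. g j x} else {j \<in> I. g j x})" for x
    by auto
  have "odd (card {j \<in> insert i I. g j x}) \<longleftrightarrow> (g i x \<noteq> odd (card {j \<in> I. g j x}))" for x
    unfolding * using insert.hyps by auto
  then have "(\<lambda>x. odd (card {j \<in> insert i I. g j x})) =
      (\<lambda>x. g i x \<noteq> odd (card {j \<in> I. g j x}))" by (rule ext)
  moreover have "\<dots> \<in> aspan S" using insert.IH insert.prems by (intro aspan.add) auto
  ultimately show ?case by (simp only:)
qed

text \<open>List version for XOR gates, whose argument lists may repeat a wire.\<close>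

lemma aspan_odd_filter:
  assumes "\<And>i. i \<in> set is \<Longrightarrow> g i \<in> aspan S"
  shows "(\<lambda>x. odd (length (filter (\<lambda>i. g i x) is))) \<in> aspan S"
  using assms
proof (induction "is")
  case Nil
  show ?case using aspan.const[of False] by simp
next
  case (Cons i "is")
  have "odd (length (filter (\<lambda>i. g i x) (i # is))) \<longleftrightarrow>
      (g i x \<noteq> odd (length (filter (\<lambda>i. g i x) is)))" for x
    by auto
  then have "(\<lambda>x. odd (length (filter (\<lambda>i. g i x) (i # is)))) =
      (\<lambda>x. g i x \<noteq> odd (length (filter (\<lambda>i. g i x) is)))" by (rule ext)
  moreover have "\<dots> \<in> aspan S" using Cons by (intro aspan.add) auto
  ultimately show ?case by (simp only:)
qed

lemma even_card_symdiff:
  assumes "finite A" "finite B"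
  shows "even (card ((A - B) \<union> (B - A))) \<longleftrightarrow> (even (card A) \<longleftrightarrow> even (card B))"
proof -
  have "card A = card (A - B) + card (A \<inter> B)" "card B = card (B - A) + card (A \<inter> B)"
    using assms card_Diff_subset_Int[of A B] card_Diff_subset_Int[of B A]
      card_mono[of A "A \<inter> B"] card_mono[of B "A \<inter> B"] by (auto simp: Int_commute)
  moreover have "card ((A - B) \<union> (B - A)) = card (A - B) + card (B - A)"
    using assms by (intro card_Un_disjoint) auto
  ultimately show ?thesis by (cases "even (card (A \<inter> B))") simp_all
qed

text \<open>Modulo the span of \<open>E\<close>, a function in the larger span is a sum over a
  subset of \<open>G\<close>. Counting such subsets later replaces a dimension argument.\<close>

lemma aspan_Un_decomp:
  assumes "f \<in> aspan (E \<union> G)" "finite G"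
  shows "\<exists>H \<subseteq> G. (\<lambda>x. f x \<noteq> odd (card {h \<in> H. h x})) \<in> aspan E"
  using assms(1)
proof (induction rule: aspan.induct)
  case (const c)
  show ?case by (rule exI[of _ "{}"]) (auto intro: aspan.const)
next
  case (base f)
  show ?case
  proof (cases "f \<in> E")
    case True
    then show ?thesis by (intro exI[of _ "{}"]) (auto intro: aspan.base)
  next
    case False
    have "{h \<in> {f}. h x} = (if f x then {f} else {})" for x by auto
    then have "(\<lambda>x. f x \<noteq> odd (card {h \<in> {f}. h x})) = (\<lambda>_. False)" by (auto simp: fun_eq_iff)
    then show ?thesis using False base aspan.const[of False E] by (intro exI[of _ "{f}"]) auto
  qed
next
  case (add f g)
  then obtain H K where H: "H \<subseteq> G" "(\<lambda>x. f x \<noteq> odd (card {h \<in> H. h x})) \<in> aspan E"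
    and K: "K \<subseteq> G" "(\<lambda>x. g x \<noteq> odd (card {h \<in> K. h x})) \<in> aspan E" by blast
  \<comment> \<open>Functions occurring in both \<open>H\<close> and \<open>K\<close> cancel in the
    sum.\<close>
  let ?D = "(H - K) \<union> (K - H)"
  have fin: "finite H" "finite K" using H K assms(2) finite_subset by auto
  have "odd (card {h \<in> ?D. h x}) \<longleftrightarrow> (odd (card {h \<in> H. h x}) \<noteq> odd (card {h \<in> K. h x}))" for x
  proof -
    let ?A = "{h \<in> H. h x}" and ?B = "{h \<in> K. h x}"
    have "{h \<in> ?D. h x} = (?A - ?B) \<union> (?B - ?A)" by blast
    then show ?thesis using even_card_symdiff[of ?A ?B] fin by auto
  qed
  then have "(\<lambda>x. (f x \<noteq> g x) \<noteq> odd (card {h \<in> ?D. h x})) =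
      (\<lambda>x. (f x \<noteq> odd (card {h \<in> H. h x})) \<noteq> (g x \<noteq> odd (card {h \<in> K. h x})))"
    by (intro ext) blast
  then have "(\<lambda>x. (f x \<noteq> g x) \<noteq> odd (card {h \<in> ?D. h x})) \<in> aspan E"
    using aspan.add[OF H(2) K(2)] by (simp only:)
  then show ?case using H(1) K(1) by (intro exI[of _ ?D]) auto
qed

section \<open>Algebraic degree\<close>

text \<open>
  The degree is at most \<open>d\<close> iff the parity over every subcube of dimension above \<open>d\<close> vanishes:
  the parity over the subcube \<open>{a \<union> T | T \<subseteq> S}\<close> is the value at \<open>a\<close> of the derivative in the
  directions \<open>S\<close>.
\<close>

definition deg_le :: "nat \<Rightarrow> bool_fun \<Rightarrow> bool" where
  "deg_le d f \<longleftrightarrow> (\<forall>S a. finite S \<longrightarrow> d < card S \<longrightarrow> a \<inter> S = {} \<longrightarrow>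
     even (card {T. T \<subseteq> S \<and> f (a \<union> T)}))"

lemma deg_leD:
  "deg_le d f \<Longrightarrow> finite S \<Longrightarrow> d < card S \<Longrightarrow> a \<inter> S = {} \<Longrightarrow>
    even (card {T. T \<subseteq> S \<and> f (a \<union> T)})"
  unfolding deg_le_def by blast

lemma deg_le_mono: "deg_le d f \<Longrightarrow> d \<le> e \<Longrightarrow> deg_le e f"
  unfolding deg_le_def by auto

lemma deg_le_False: "deg_le d (\<lambda>_. False)"
  unfolding deg_le_def by simp

lemma deg_le_True: "deg_le d (\<lambda>_. True)"
proof -
  have "even (card {T. T \<subseteq> S})" if "finite S" "d < card S" for S :: "nat set"
    using card_Pow[OF that(1)] that(2) by (simp add: Pow_def)
  then show ?thesis unfolding deg_le_def by simp
qed

lemma deg_le_xor: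
  assumes "deg_le d f" "deg_le d g"
  shows "deg_le d (\<lambda>x. f x \<noteq> g x)"
  unfolding deg_le_def
proof (intro allI impI)
  fix S a :: "nat set"
  assume S: "finite S" "d < card S" "a \<inter> S = {}"
  let ?F = "{T. T \<subseteq> S \<and> f (a \<union> T)}" and ?G = "{T. T \<subseteq> S \<and> g (a \<union> T)}"
  have "even (card ?F)" "even (card ?G)" using assms S unfolding deg_le_def by blast+
  then have "even (card ((?F - ?G) \<union> (?G - ?F)))" using S(1) by (subst even_card_symdiff) auto
  moreover have "{T. T \<subseteq> S \<and> f (a \<union> T) \<noteq> g (a \<union> T)} = (?F - ?G) \<union> (?G - ?F)" by blast
  ultimately show "even (card {T. T \<subseteq> S \<and> f (a \<union> T) \<noteq> g (a \<union> T)})" by (simp only:)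
qed

text \<open>If \<open>j\<close> is not a direction of the subcube, its value is constant there.
  Otherwise only the face with coordinate \<open>j\<close> equal to 1 contributes, a subcube of one
  dimension less.\<close>

lemma deg_le_variable_conj:
  assumes "deg_le d h"
  shows "deg_le (Suc d) (\<lambda>x. h x \<and> j \<in> x)"
  unfolding deg_le_def
proof (intro allI impI)
  fix S a :: "nat set"
  assume S: "finite S" "Suc d < card S" "a \<inter> S = {}"
  show "even (card {T. T \<subseteq> S \<and> h (a \<union> T) \<and> j \<in> a \<union> T})"
  proof (cases "j \<in> S")
    case False
    then have "{T. T \<subseteq> S \<and> h (a \<union> T) \<and> j \<in> a \<union> T} =
        (if j \<in> a then {T. T \<subseteq> S \<and> h (a \<union> T)} else {})" by auto
    then show ?thesis using assms S unfolding deg_le_def by auto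
  next
    case True
    let ?C = "{T. T \<subseteq> S - {j} \<and> h (insert j a \<union> T)}"
    have "{T. T \<subseteq> S \<and> h (a \<union> T) \<and> j \<in> a \<union> T} = insert j ` ?C"
    proof (intro equalityI subsetI)
      fix T assume "T \<in> {T. T \<subseteq> S \<and> h (a \<union> T) \<and> j \<in> a \<union> T}"
      then have T: "T \<subseteq> S" "h (a \<union> T)" "j \<in> T" using True S(3) by auto
      then have "insert j a \<union> (T - {j}) = a \<union> T" "insert j (T - {j}) = T" by auto
      then show "T \<in> insert j ` ?C" using T by (intro image_eqI[of _ _ "T - {j}"]) auto
    qed (use True in auto)
    moreover have "inj_on (insert j) ?C" by (rule inj_onI) blast
    moreover have "d < card (S - {j})" "insert j a \<inter> (S - {j}) = {}" using S True by auto
    then have "even (card ?C)"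
      using assms S(1) unfolding deg_le_def by blast
    ultimately show ?thesis by (simp add: card_image)
  qed
qed

definition variables :: "nat \<Rightarrow> bool_fun set" where
  "variables n = (\<lambda>i A. i \<in> A) ` {..<n}"

lemma deg_le_affine_conj:
  assumes "L \<in> aspan (variables n)" "deg_le d h"
  shows "deg_le (Suc d) (\<lambda>x. h x \<and> L x)"
  using assms(1)
proof (induction rule: aspan.induct)
  case (const c)
  show ?case using deg_le_mono[OF assms(2)] deg_le_False by (cases c) auto
next
  case (base f)
  then show ?case using deg_le_variable_conj[OF assms(2)] by (auto simp: variables_def)
next
  case (add f g)
  \<comment> \<open>Conjunction distributes over XOR, so the bound passes from variables to affine
    functions.\<close>
  have "(\<lambda>x. h x \<and> f x \<noteq> g x) = (\<lambda>x. (h x \<and> f x) \<noteq> (h x \<and> g x))" by (intro ext) blast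
  then show ?case using deg_le_xor[OF add.IH] by (simp only:)
qed

section \<open>Chains of conjunctions\<close>

text \<open>Normal form of a circuit: XOR and NOT gates are absorbed into the arguments of the
  conjunctions, so the length of the list is the cost.\<close>

fun and_chain :: "('a \<Rightarrow> bool) set \<Rightarrow> ('a \<Rightarrow> bool) list \<Rightarrow> bool" where
  "and_chain S [] \<longleftrightarrow> True"
| "and_chain S (h # hs) \<longleftrightarrow>
     (\<exists>f \<in> aspan S. \<exists>g \<in> aspan S. h = (\<lambda>x. f x \<and> g x)) \<and> and_chain (insert h S) hs"

lemma and_chain_append:
  "and_chain S (hs @ ks) \<longleftrightarrow> and_chain S hs \<and> and_chain (S \<union> set hs) ks"
  by (induction hs arbitrary: S) auto

text \<open>
  The degree may double at a single gate, so the bound is not proved gate by gate. Instead, the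
  cube is split according to the first argument of each gate: on each part every function of the
  chain is affine, and each split raises the degree of the indicator \<open>R\<close> of a part by one.
\<close>

lemma and_chain_deg_le_on:
  assumes "and_chain S hs" "deg_le d R"
    and "\<And>g. g \<in> S \<Longrightarrow> \<exists>L \<in> aspan (variables n). \<forall>x. R x \<longrightarrow> g x = L x"
    and "f \<in> aspan (S \<union> set hs)"
  shows "deg_le (Suc (d + length hs)) (\<lambda>x. R x \<and> f x)"
  using assms
proof (induction hs arbitrary: S d R)
  case Nil
  have "f \<in> aspan S" using Nil.prems(4) by simp
  then obtain L where "L \<in> aspan (variables n)" "\<forall>x. R x \<longrightarrow> f x = L x"
    using aspan_agrees_on[of f S "variables n" R] Nil.prems(3) by blast
  then have "(\<lambda>x. R x \<and> f x) = (\<lambda>x. R x \<and> L x)" "L \<in> aspan (variables n)" by auto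
  then show ?case using deg_le_affine_conj[of L n d R] Nil.prems(2) by simp
next
  case (Cons h hs)
  note aff = aspan_agrees_on[of _ S "variables n" R, OF _ Cons.prems(3)]
  obtain p q where pq: "p \<in> aspan S" "q \<in> aspan S" "h = (\<lambda>x. p x \<and> q x)"
    and chain: "and_chain (insert h S) hs" using Cons.prems(1) by auto
  obtain L where L: "L \<in> aspan (variables n)" "\<forall>x. R x \<longrightarrow> p x = L x" using aff pq by blast
  obtain M where M: "M \<in> aspan (variables n)" "\<forall>x. R x \<longrightarrow> q x = M x" using aff pq by blast
  have f: "f \<in> aspan (insert h S \<union> set hs)" using Cons.prems(4) by simp
  \<comment> \<open>Where \<open>L\<close> holds, \<open>p\<close> is true, so \<open>h\<close>
    agrees with the affine function \<open>M\<close>.\<close>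
  have 1: "deg_le (Suc (Suc d + length hs)) (\<lambda>x. (R x \<and> L x) \<and> f x)"
  proof (rule Cons.IH[OF chain deg_le_affine_conj[OF L(1) Cons.prems(2)] _ f])
    fix g assume "g \<in> insert h S"
    then show "\<exists>K \<in> aspan (variables n). \<forall>x. R x \<and> L x \<longrightarrow> g x = K x"
      using L M pq Cons.prems(3) by (metis insertE)
  qed
  \<comment> \<open>Where \<open>L\<close> fails, \<open>p\<close> is false, so \<open>h\<close> is
    constantly false.\<close>
  have 2: "deg_le (Suc (Suc d + length hs)) (\<lambda>x. (R x \<and> \<not> L x) \<and> f x)"
  proof (rule Cons.IH[OF chain deg_le_affine_conj[OF aspan_neg[OF L(1)] Cons.prems(2)] _ f])
    fix g assume "g \<in> insert h S"
    then show "\<exists>K \<in> aspan (variables n). \<forall>x. R x \<and> \<not> L x \<longrightarrow> g x = K x"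
      using L pq Cons.prems(3) aspan.const[of False "variables n"] by (metis insertE)
  qed
  \<comment> \<open>The two parts are disjoint, so their union is an XOR and the degree bound
    carries over.\<close>
  have "(\<lambda>x. R x \<and> f x) = (\<lambda>x. ((R x \<and> L x) \<and> f x) \<noteq> ((R x \<and> \<not> L x) \<and> f x))" by (intro ext) blast
  then show ?case using deg_le_xor[OF 1 2] by (simp only: add_Suc add_Suc_right add_0_right list.size)
qed

lemma and_chain_deg_le:
  assumes "and_chain (variables n) hs" "f \<in> aspan (variables n \<union> set hs)"
  shows "deg_le (Suc (length hs)) f"
proof -
  \<comment> \<open>Start with the whole cube as a single part: its indicator has degree 0, and
    variables are affine on it.\<close>
  have "deg_le (Suc (0 + length hs)) (\<lambda>x. True \<and> f x)"
    by (rule and_chain_deg_le_on[OF assms(1) deg_le_True _ assms(2)]) (blast intro: aspan.base)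
  then show ?thesis by simp
qed

section \<open>Lower bound on the number of conjunctions\<close>

definition conj_others :: "nat \<Rightarrow> nat \<Rightarrow> bool_fun" where
  "conj_others n i A \<longleftrightarrow> (\<forall>j \<in> {..<n} - {i}. j \<in> A)"

text \<open>
  The first \<open>n - 3\<close> conjunctions have degree at most \<open>n - 2\<close>, while the outputs are linearly
  independent modulo functions of that degree.
\<close>

lemma and_chain_conj_others_length:
  assumes n: "3 \<le> n" and chain: "and_chain (variables n) hs"
    and out: "\<And>i. i < n \<Longrightarrow> conj_others n i \<in> aspan (variables n \<union> set hs)"
  shows "2 * n - 3 \<le> length hs"
proof -
  define E where "E = variables n \<union> set (take (n - 3) hs)"
  define G where "G = set (drop (n - 3) hs)"
  have EG: "variables n \<union> set hs = E \<union> G"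
    unfolding E_def G_def Un_assoc set_append[symmetric] by simp
  have "and_chain (variables n) (take (n - 3) hs)"
    using chain and_chain_append[of _ "take (n - 3) hs" "drop (n - 3) hs"] by simp
  then have "deg_le (Suc (length (take (n - 3) hs))) f" if "f \<in> aspan E" for f
    using that unfolding E_def by (rule and_chain_deg_le)
  moreover have "Suc (length (take (n - 3) hs)) \<le> n - 2" using n by simp
  ultimately have degE: "deg_le (n - 2) f" if "f \<in> aspan E" for f
    using that deg_le_mono by blast
  have xor_cancel: "(p \<noteq> q) = ((p \<noteq> r) \<noteq> (q \<noteq> r))" for p q r :: bool by blast
  \<comment> \<open>\<open>F K\<close> is the sum of the outputs in \<open>K\<close>. Modulo the
    span of \<open>E\<close> it equals the sum over some \<open>H K\<close> contained in
    \<open>G\<close>; injectivity of \<open>H\<close> will give 2^n <= 2^(card G).\<close>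
  define F where "F K A = odd (card {i \<in> K. conj_others n i A})" for K A
  have "\<exists>H. H \<subseteq> G \<and> (\<lambda>x. F K x \<noteq> odd (card {h \<in> H. h x})) \<in> aspan E" if "K \<subseteq> {..<n}" for K
  proof -
    have "F K \<in> aspan (E \<union> G)"
      unfolding F_def EG[symmetric] using that out
      by (intro aspan_odd_card) (auto intro: finite_subset)
    then show ?thesis by (rule aspan_Un_decomp) (simp add: G_def)
  qed
  then have "\<forall>K \<in> Pow {..<n}. \<exists>H. H \<subseteq> G \<and> (\<lambda>x. F K x \<noteq> odd (card {h \<in> H. h x})) \<in> aspan E"
    by (intro ballI) (drule PowD)
  from bchoice[OF this] obtain H where H0: "\<forall>K \<in> Pow {..<n}. H K \<subseteq> G \<and>
    (\<lambda>x. F K x \<noteq> odd (card {h \<in> H K. h x})) \<in> aspan E" by (elim exE)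
  have H: "H K \<subseteq> G" "(\<lambda>x. F K x \<noteq> odd (card {h \<in> H K. h x})) \<in> aspan E"
    if "K \<subseteq> {..<n}" for K
    using bspec[OF H0 PowI[OF that]] by simp_all
  have "inj_on H (Pow {..<n})"
  proof (rule inj_onI, rule ccontr)
    fix K K' assume K: "K \<in> Pow {..<n}" "K' \<in> Pow {..<n}" "H K = H K'" "K \<noteq> K'"
    then obtain i where i: "i < n" "i \<in> K \<longleftrightarrow> i \<notin> K'" by blast
    \<comment> \<open>If \<open>H K = H K'\<close>, the two sums over \<open>G\<close> cancel, so
      the difference of \<open>F K\<close> and \<open>F K'\<close> lies in the span of
      \<open>E\<close> and has degree at most \<open>n - 2\<close>.\<close>
    have "(\<lambda>x. F K x \<noteq> F K' x) =
        (\<lambda>x. (F K x \<noteq> odd (card {h \<in> H K. h x})) \<noteq> (F K' x \<noteq> odd (card {h \<in> H K'. h x})))"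
      unfolding K(3) by (intro ext xor_cancel)
    moreover have "\<dots> \<in> aspan E" using K(1,2) by (intro aspan.add H(2)) auto
    ultimately have "(\<lambda>x. F K x \<noteq> F K' x) \<in> aspan E" by (simp only:)
    then have "deg_le (n - 2) (\<lambda>x. F K x \<noteq> F K' x)" by (rule degE)
    \<comment> \<open>Test this on the subcube of dimension \<open>n - 1\<close> with coordinate
      \<open>i\<close> equal to 0. Every output other than the one for \<open>i\<close> vanishes
      there, and that one is true at a single point, which makes the parity odd.\<close>
    then have ev: "even (card {T. T \<subseteq> {..<n} - {i} \<and> F K ({} \<union> T) \<noteq> F K' ({} \<union> T)})"
      using i n by (intro deg_leD) auto
    have conj: "conj_others n k T \<longleftrightarrow> k = i \<and> T = {..<n} - {i}"
      if "T \<subseteq> {..<n} - {i}" "k < n" for k T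
      using that i unfolding conj_others_def by auto
    have F: "F J T \<longleftrightarrow> i \<in> J \<and> T = {..<n} - {i}" if "T \<subseteq> {..<n} - {i}" "J \<subseteq> {..<n}" for J T
    proof -
      have "{k \<in> J. conj_others n k T} = (if i \<in> J \<and> T = {..<n} - {i} then {i} else {})"
        using conj[OF that(1)] that(2) by auto
      then show ?thesis unfolding F_def by simp
    qed
    have "F K T \<noteq> F K' T \<longleftrightarrow> T = {..<n} - {i}" if "T \<subseteq> {..<n} - {i}" for T
      using F[OF that, of K] F[OF that, of K'] i(2) K(1,2) by blast
    then have "{T. T \<subseteq> {..<n} - {i} \<and> F K ({} \<union> T) \<noteq> F K' ({} \<union> T)} = {{..<n} - {i}}"
      unfolding Un_empty_left by blast
    then show False using ev by (simp only: card.insert) simp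
  qed
  moreover have "H ` Pow {..<n} \<subseteq> Pow G" using H(1) by auto
  ultimately have "card (Pow {..<n}) \<le> card (Pow G)"
    by (intro card_inj_on_le) (auto simp: G_def)
  then have "(2::nat) ^ n \<le> 2 ^ card G" by (simp add: card_Pow G_def)
  then have "n \<le> card G" by simp
  also have "\<dots> \<le> length hs - (n - 3)" unfolding G_def using card_length[of "drop (n - 3) hs"] by simp
  finally show ?thesis using n by simp
qed

section \<open>Circuits and chains\<close>

definition point :: "nat \<Rightarrow> nat set \<Rightarrow> bool list" where
  "point n A = map (\<lambda>i. i \<in> A) [0..<n]"

definition wires :: "nat \<Rightarrow> gate list \<Rightarrow> bool_fun set" where
  "wires n gs = (\<lambda>k A. wire_vals gs (point n A) ! k) ` {..<n + length gs}"

lemma length_wire_vals [simp]: "length (wire_vals gs xs) = length xs + length gs"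
  by (induction gs rule: rev_induct) (auto simp: wire_vals_def)

lemma wire_vals_snoc:
  "wire_vals (gs @ [g]) xs = wire_vals gs xs @ [gate_val (wire_vals gs xs) g]"
  by (simp add: wire_vals_def)

lemma wires_Nil: "wires n [] = variables n"
  unfolding wires_def variables_def wire_vals_def point_def by (auto intro!: image_cong)

lemma wires_snoc:
  "wires n (gs @ [g]) = insert (\<lambda>A. gate_val (wire_vals gs (point n A)) g) (wires n gs)"
proof -
  have "{..<n + length (gs @ [g])} = insert (n + length gs) {..<n + length gs}" by auto
  then show ?thesis
    unfolding wires_def wire_vals_snoc
    by (simp only: image_insert, intro arg_cong2[of _ _ _ _ insert] image_cong) (auto simp: nth_append point_def fun_eq_iff)
qed

text \<open>With an empty output list, well-formedness concerns the gates only and can be checked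
  gate by gate.\<close>

lemma wf_circuit_snoc:
  "wf_circuit n (Circuit (gs @ [g]) []) \<longleftrightarrow>
     wf_circuit n (Circuit gs []) \<and> gate_args g \<subseteq> {..<n + length gs}"
  unfolding wf_circuit_def by (auto simp: less_Suc_eq nth_append all_conj_distrib)

text \<open>An AND gate appends one conjunction with arguments in the current span; XOR and NOT
  gates do not leave that span.\<close>

lemma ex_and_chain:
  assumes "wf_circuit n (Circuit gs [])"
  shows "\<exists>hs. and_chain (variables n) hs \<and> length hs = length (filter is_and_gate gs) \<and>
    wires n gs \<subseteq> aspan (variables n \<union> set hs)"
  using assms
proof (induction gs rule: rev_induct)
  case Nil
  show ?case by (rule exI[of _ "[]"]) (auto simp: wires_Nil intro: aspan.base)
next
  case (snoc g gs)
  then obtain hs where hs: "and_chain (variables n) hs"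
    "length hs = length (filter is_and_gate gs)" "wires n gs \<subseteq> aspan (variables n \<union> set hs)"
    by (auto simp: wf_circuit_snoc)
  have args: "gate_args g \<subseteq> {..<n + length gs}" using snoc.prems by (simp add: wf_circuit_snoc)
  then have arg: "(\<lambda>A. wire_vals gs (point n A) ! a) \<in> aspan (variables n \<union> set hs)"
    if "a \<in> gate_args g" for a
    using that hs(3) unfolding wires_def by auto
  show ?case
  proof (cases "is_and_gate g")
    case True
    then obtain a b where g: "g = AndGate a b" by (cases g) auto
    let ?h = "\<lambda>A. wire_vals gs (point n A) ! a \<and> wire_vals gs (point n A) ! b"
    have "and_chain (variables n) (hs @ [?h])"
      unfolding and_chain_append and_chain.simps using hs(1) arg g
      by (intro conjI bexI[of _ "\<lambda>A. wire_vals gs (point n A) ! a"]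
          bexI[of _ "\<lambda>A. wire_vals gs (point n A) ! b"]) auto
    moreover have "wires n (gs @ [g]) \<subseteq> aspan (variables n \<union> set (hs @ [?h]))"
    proof
      fix f assume "f \<in> wires n (gs @ [g])"
      then consider "f = ?h" | "f \<in> aspan (variables n \<union> set hs)"
        using hs(3) by (auto simp: wires_snoc g)
      then show "f \<in> aspan (variables n \<union> set (hs @ [?h]))"
        by cases (auto intro: aspan.base elim!: aspan_mono)
    qed
    ultimately show ?thesis using hs(2) g by (intro exI[of _ "hs @ [?h]"]) simp
  next
    case False
    have "(\<lambda>A. gate_val (wire_vals gs (point n A)) g) \<in> aspan (variables n \<union> set hs)"
    proof (cases g)
      case (XorGate as)
      then show ?thesis using arg by (auto intro!: aspan_odd_filter)
    next
      case (NotGate a)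
      then show ?thesis using arg by (auto intro!: aspan_neg)
    qed (use False in simp)
    then show ?thesis using hs False by (intro exI[of _ hs]) (simp add: wires_snoc)
  qed
qed

section \<open>Assembling circuits from available functions, without tracking wire numbers\<close>

definition realizes :: "nat \<Rightarrow> nat \<Rightarrow> bool_fun set \<Rightarrow> bool" where
  "realizes n c F \<longleftrightarrow> (\<exists>gs. wf_circuit n (Circuit gs []) \<and>
     length (filter is_and_gate gs) = c \<and> F \<subseteq> wires n gs)"

lemma realizes_subset: "realizes n c F \<Longrightarrow> G \<subseteq> F \<Longrightarrow> realizes n c G"
  unfolding realizes_def by blast

lemma realizes_variables: "realizes n 0 (variables n)"
  unfolding realizes_def by (rule exI[of _ "[]"]) (simp add: wires_Nil wf_circuit_def)

lemma realizes_and: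
  assumes "realizes n c F" "f \<in> F" "g \<in> F"
  shows "realizes n (Suc c) (insert (\<lambda>A. f A \<and> g A) F)"
proof -
  obtain gs where gs: "wf_circuit n (Circuit gs [])" "length (filter is_and_gate gs) = c"
    "F \<subseteq> wires n gs" using assms(1) unfolding realizes_def by blast
  obtain a b where "a < n + length gs" "f = (\<lambda>A. wire_vals gs (point n A) ! a)"
    "b < n + length gs" "g = (\<lambda>A. wire_vals gs (point n A) ! b)"
    using gs(3) assms(2,3) unfolding wires_def by blast
  then show ?thesis using gs unfolding realizes_def
    by (intro exI[of _ "gs @ [AndGate a b]"]) (auto simp: wf_circuit_snoc wires_snoc)
qed

lemma realizes_not:
  assumes "realizes n c F" "f \<in> F"
  shows "realizes n c (insert (\<lambda>A. \<not> f A) F)"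
proof -
  obtain gs where gs: "wf_circuit n (Circuit gs [])" "length (filter is_and_gate gs) = c"
    "F \<subseteq> wires n gs" using assms(1) unfolding realizes_def by blast
  obtain a where "a < n + length gs" "f = (\<lambda>A. wire_vals gs (point n A) ! a)"
    using gs(3) assms(2) unfolding wires_def by blast
  then show ?thesis using gs unfolding realizes_def
    by (intro exI[of _ "gs @ [NotGate a]"]) (auto simp: wf_circuit_snoc wires_snoc)
qed

lemma realizes_xor:
  assumes "realizes n c F" "f \<in> F" "g \<in> F"
  shows "realizes n c (insert (\<lambda>A. f A \<noteq> g A) F)"
proof -
  obtain gs where gs: "wf_circuit n (Circuit gs [])" "length (filter is_and_gate gs) = c"
    "F \<subseteq> wires n gs" using assms(1) unfolding realizes_def by blast
  obtain a b where ab: "a < n + length gs" "f = (\<lambda>A. wire_vals gs (point n A) ! a)"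
    "b < n + length gs" "g = (\<lambda>A. wire_vals gs (point n A) ! b)"
    using gs(3) assms(2,3) unfolding wires_def by blast
  then have "(\<lambda>A. gate_val (wire_vals gs (point n A)) (XorGate [a, b])) = (\<lambda>A. f A \<noteq> g A)"
    by auto
  then show ?thesis using gs ab(1,3) unfolding realizes_def
    by (intro exI[of _ "gs @ [XorGate [a, b]]"]) (auto simp: wf_circuit_snoc wires_snoc)
qed

lemma realizes_False:
  assumes "realizes n c F"
  shows "realizes n c (insert (\<lambda>_. False) F)"
proof -
  obtain gs where "wf_circuit n (Circuit gs [])" "length (filter is_and_gate gs) = c"
    "F \<subseteq> wires n gs" using assms(1) unfolding realizes_def by blast
  \<comment> \<open>The XOR of no wires is False.\<close>
  then show ?thesis unfolding realizes_def
    by (intro exI[of _ "gs @ [XorGate []]"]) (auto simp: wf_circuit_snoc wires_snoc)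
qed

text \<open>The set \<open>F\<close> varies in the induction, since one summand is added on top of
  the other before their XOR is formed.\<close>

lemma realizes_aspan:
  assumes "f \<in> aspan S" "realizes n c F" "S \<subseteq> F"
  shows "realizes n c (insert f F)"
  using assms
proof (induction arbitrary: F rule: aspan.induct)
  case (const b)
  have "realizes n c (insert (\<lambda>_. True) (insert (\<lambda>_. False) F))"
    using realizes_not[OF realizes_False[OF const.prems(1)], of "\<lambda>_. False"] by simp
  then show ?case by (rule realizes_subset) (cases b; auto)
next
  case (base f)
  then have "insert f F = F" by auto
  then show ?case using base.prems by simp
next
  case (add f g)
  have "realizes n c (insert f (insert g F))" using add by blast
  from realizes_xor[OF this, of f g] show ?case by (rule realizes_subset[OF _ subsetI]) auto
qed

lemma realizes_aspan_subset:
  assumes "finite G" "G \<subseteq> aspan F" "realizes n c F"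
  shows "realizes n c (G \<union> F)"
  using assms by (induction G rule: finite_induct) (auto intro: realizes_aspan)

lemma realizes_aspan_and:
  assumes "realizes n c F" "f \<in> aspan F" "g \<in> aspan F"
  shows "realizes n (Suc c) (insert (\<lambda>A. f A \<and> g A) F)"
proof -
  have "realizes n c ({f, g} \<union> F)" using assms by (intro realizes_aspan_subset) auto
  from realizes_and[OF this, of f g] show ?thesis by (rule realizes_subset[OF _ subsetI]) auto
qed

lemma ex_computes:
  assumes "realizes n c (set fs)"
  shows "\<exists>C. computes n C (\<lambda>xs. map (\<lambda>f. f {i. i < n \<and> xs ! i}) fs) \<and> and_count C = c"
proof -
  obtain gs where gs: "wf_circuit n (Circuit gs [])" "length (filter is_and_gate gs) = c"
    "set fs \<subseteq> wires n gs" using assms unfolding realizes_def by blast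
  then have "\<forall>f \<in> set fs. \<exists>k < n + length gs. \<forall>A. wire_vals gs (point n A) ! k = f A"
    unfolding wires_def by fastforce
  then obtain k where k: "\<And>f. f \<in> set fs \<Longrightarrow> k f < n + length gs"
    "\<And>f A. f \<in> set fs \<Longrightarrow> wire_vals gs (point n A) ! k f = f A" by metis
  let ?C = "Circuit gs (map k fs)"
  have "circuit_eval ?C xs = map (\<lambda>f. f {i. i < n \<and> xs ! i}) fs" if "length xs = n" for xs
  proof -
    \<comment> \<open>On lists of length \<open>n\<close>, taking the set of true positions is
      inverted by \<open>point n\<close>.\<close>
    have "point n {i. i < n \<and> xs ! i} = xs"
      using that unfolding point_def by (intro nth_equalityI) auto
    then show ?thesis unfolding circuit_eval_def using k(2) by auto metis+
  qed
  moreover have "wf_circuit n ?C" using gs(1) k(1) unfolding wf_circuit_def by auto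
  ultimately show ?thesis using gs(2) unfolding computes_def and_count_def by force
qed

section \<open>The optimal circuit\<close>

definition at_most_one_zero :: "nat \<Rightarrow> bool_fun" where
  "at_most_one_zero m A \<longleftrightarrow> card ({..<m} - A) \<le> 1"

definition parity :: "nat \<Rightarrow> bool_fun" where
  "parity m A \<longleftrightarrow> odd (card {i \<in> {..<m}. i \<in> A})"

lemma variable_in_aspan: "i < n \<Longrightarrow> variables n \<subseteq> F \<Longrightarrow> (\<lambda>A. i \<in> A) \<in> aspan F"
  by (rule aspan.base) (auto simp: variables_def)

lemma parity_in_aspan: "m \<le> n \<Longrightarrow> variables n \<subseteq> F \<Longrightarrow> parity m \<in> aspan F"
  unfolding parity_def[abs_def] by (intro aspan_odd_card variable_in_aspan) auto

text \<open>The ones and the zeros together number \<open>m\<close>, which is odd.\<close>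

lemma parity_zeros:
  assumes "odd m"
  shows "parity m A \<longleftrightarrow> even (card ({..<m} - A))"
proof -
  have "card ({..<m} - A) + card {i \<in> {..<m}. i \<in> A} = card (({..<m} - A) \<union> {i \<in> {..<m}. i \<in> A})"
    by (intro card_Un_disjoint[symmetric]) auto
  also have "({..<m} - A) \<union> {i \<in> {..<m}. i \<in> A} = {..<m}" by auto
  finally show ?thesis using assms unfolding parity_def by (metis card_lessThan even_add)
qed

text \<open>The form of the majority function with a single conjunction.\<close>

definition majority :: "bool \<Rightarrow> bool \<Rightarrow> bool \<Rightarrow> bool" where
  "majority a b c \<longleftrightarrow> (((a \<noteq> b) \<and> (a \<noteq> c)) \<noteq> a)"

text \<open>
  If the first \<open>m\<close> coordinates contain at most one zero, then their parity tells whether there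
  is one, as \<open>m\<close> is odd.
\<close>

lemma at_most_one_zero_step:
  assumes "odd m"
  shows "at_most_one_zero (m + 2) A \<longleftrightarrow>
    at_most_one_zero m A \<and> majority (parity m A) (m \<in> A) (Suc m \<in> A)"
proof -
  have *: "{..<m + 2} - A = ({..<m} - A) \<union> ({m, Suc m} - A)" by auto
  have "card ({..<m + 2} - A) = card ({..<m} - A) + card ({m, Suc m} - A)"
    unfolding * by (intro card_Un_disjoint) auto
  moreover have "card ({m, Suc m} - A) = of_bool (m \<notin> A) + of_bool (Suc m \<notin> A)"
    by (auto simp: insert_Diff_if)
  \<comment> \<open>\<open>z\<close> stands for the number of zeros among the first \<open>m\<close>
    coordinates. For \<open>z = 0\<close> the majority permits one further zero, for
    \<open>z = 1\<close> none, and for larger \<open>z\<close> both sides fail.\<close>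
  moreover have "z + (of_bool p + of_bool q) \<le> 1 \<longleftrightarrow> z \<le> 1 \<and> majority (even z) (\<not> p) (\<not> q)"
    for z :: nat and p q
  proof -
    consider "z = 0" | "z = 1" | "2 \<le> z" by linarith
    then show ?thesis by cases (cases p; cases q; simp add: majority_def)+
  qed
  ultimately show ?thesis unfolding at_most_one_zero_def parity_zeros[OF assms] by simp
qed

lemma realizes_majority:
  assumes "realizes n c F" "f \<in> aspan F" "g \<in> aspan F" "h \<in> aspan F"
  shows "realizes n (Suc c) (insert (\<lambda>A. majority (f A) (g A) (h A)) F)"
proof -
  let ?p = "\<lambda>A. (f A \<noteq> g A) \<and> (f A \<noteq> h A)"
  have "realizes n (Suc c) (insert ?p F)"
    using assms by (intro realizes_aspan_and aspan.add)
  moreover have "(\<lambda>A. majority (f A) (g A) (h A)) \<in> aspan (insert ?p F)"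
    unfolding majority_def using assms(2)
    by (intro aspan.add) (auto intro: aspan.base aspan_mono)
  ultimately have "realizes n (Suc c) (insert (\<lambda>A. majority (f A) (g A) (h A)) (insert ?p F))"
    using realizes_aspan by blast
  then show ?thesis by (rule realizes_subset) auto
qed

text \<open>Each step costs one conjunction for the majority and one for the product with it. The
  first step needs no product, which gives 1 + 2(k - 1).\<close>

lemma realizes_at_most_one_zero:
  assumes "1 \<le> k" "2 * k + 1 \<le> n"
  shows "realizes n (2 * k - 1) (insert (at_most_one_zero (2 * k + 1)) (variables n))"
  using assms
proof (induction k rule: dec_induct)
  let ?maj = "\<lambda>m A. majority (parity m A) (m \<in> A) (Suc m \<in> A)"
  have maj: "realizes n (Suc c) (insert (?maj m) F)"
    if "m + 2 \<le> n" "realizes n c F" "variables n \<subseteq> F" for m c F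
    using that by (intro realizes_majority variable_in_aspan parity_in_aspan) auto
  {
    case base
    \<comment> \<open>A single coordinate never has two zeros, so the first factor is constantly
      true.\<close>
    have "at_most_one_zero 1 A" for A
      unfolding at_most_one_zero_def using card_mono[of "{..<1::nat}" "{..<1} - A"] by simp
    then have "at_most_one_zero (2 * 1 + 1) = ?maj 1"
      using at_most_one_zero_step[of 1] by (auto simp: fun_eq_iff numeral_3_eq_3)
    then show ?case using maj[of 1 0 "variables n"] realizes_variables base by simp
  next
    case (step k)
    let ?m = "2 * k + 1"
    let ?F = "insert (?maj ?m) (insert (at_most_one_zero ?m) (variables n))"
    have "realizes n (Suc (2 * k - 1)) ?F" using step by (intro maj) auto
    then have "realizes n (Suc (Suc (2 * k - 1)))
        (insert (\<lambda>A. at_most_one_zero ?m A \<and> ?maj ?m A) ?F)"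
      by (intro realizes_and) auto
    moreover have "(\<lambda>A. at_most_one_zero ?m A \<and> ?maj ?m A) = at_most_one_zero (2 * Suc k + 1)"
      using at_most_one_zero_step[of ?m] by (auto simp: fun_eq_iff)
    moreover have "Suc (Suc (2 * k - 1)) = 2 * Suc k - 1" using step.hyps by simp
    ultimately have "realizes n (2 * Suc k - 1) (insert (at_most_one_zero (2 * Suc k + 1)) ?F)"
      by (simp only:)
    then show ?case by (rule realizes_subset) auto
  }
qed

section \<open>Linear relations among the outputs\<close>

lemma zeros_cases:
  fixes Z :: "nat set"
  assumes "finite Z"
  obtains "Z = {}" | z where "Z = {z}" | "2 \<le> card Z"
  using assms by (metis One_nat_def card_0_eq card_1_singletonE less_2_cases not_le)

lemma conj_others_zeros: "conj_others m i A \<longleftrightarrow> {..<m} - A \<subseteq> {i}"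
  unfolding conj_others_def by auto

text \<open>With two or more zeros every term is false; with none, both outputs are true and
  coordinates \<open>i\<close> and \<open>j\<close> agree. With a single zero \<open>z\<close>, an
  output is true exactly when its index is \<open>z\<close>.\<close>

lemma conj_others_xor:
  assumes "i < m" "j < m"
  shows "conj_others m i A \<longleftrightarrow>
    ((at_most_one_zero m A \<and> ((i \<in> A) \<noteq> (j \<in> A))) \<noteq> conj_others m j A)"
proof -
  let ?Z = "{..<m} - A"
  have mem: "i \<in> A \<longleftrightarrow> i \<notin> ?Z" "j \<in> A \<longleftrightarrow> j \<notin> ?Z" using assms by auto
  have "finite ?Z" by simp
  then show ?thesis
  proof (cases rule: zeros_cases)
    case 3
    then have "\<not> ?Z \<subseteq> {l}" for l using card_mono[of "{l}" ?Z] by auto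
    then show ?thesis using 3 unfolding conj_others_zeros at_most_one_zero_def by simp
  next
    case 1
    show ?thesis unfolding conj_others_zeros at_most_one_zero_def mem 1 by simp
  next
    case (2 z)
    show ?thesis unfolding conj_others_zeros at_most_one_zero_def mem 2 by auto
  qed
qed

text \<open>
  Modulo 2, the outputs sum to \<open>at_most_one_zero m\<close> because \<open>m\<close> is odd; so the differences
  \<open>f\<^sub>i + f\<^sub>0\<close> determine \<open>f\<^sub>0\<close>.
\<close>

lemma conj_others_0:
  assumes "odd m"
  shows "conj_others m 0 A \<longleftrightarrow> (at_most_one_zero m A \<noteq>
    odd (card {i \<in> {1..<m}. at_most_one_zero m A \<and> ((i \<in> A) \<noteq> (0 \<in> A))}))"
proof -
  let ?Z = "{..<m} - A"
  have 0: "0 < m" using assms by (rule odd_pos)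
  have eq: "{i \<in> {1..<m}. at_most_one_zero m A \<and> ((i \<in> A) \<noteq> (0 \<in> A))} =
      {i \<in> {1..<m}. card ?Z \<le> 1 \<and> ((i \<in> ?Z) \<noteq> (0 \<in> ?Z))}"
    using 0 by (auto simp: at_most_one_zero_def)
  have "finite ?Z" by simp
  then show ?thesis
  proof (cases rule: zeros_cases)
    case 1
    show ?thesis unfolding eq unfolding conj_others_zeros at_most_one_zero_def 1 by simp
  next
    case (2 z)
    show ?thesis
    proof (cases "z = 0")
      case True
      \<comment> \<open>All \<open>m - 1\<close> other coordinates differ from coordinate 0; this
        number is even, so the sum of the differences vanishes.\<close>
      then have "{i \<in> {1..<m}. card ?Z \<le> 1 \<and> ((i \<in> ?Z) \<noteq> (0 \<in> ?Z))} = {1..<m}"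
        unfolding 2 by auto
      then show ?thesis unfolding eq using 2 True assms 0
        by (simp add: conj_others_zeros at_most_one_zero_def)
    next
      case False
      have "z < m" using 2 by blast
      \<comment> \<open>Only coordinate \<open>z\<close> differs from coordinate 0, so the sum of
        the differences is 1 and cancels \<open>at_most_one_zero m\<close>.\<close>
      then have "{i \<in> {1..<m}. card ?Z \<le> 1 \<and> ((i \<in> ?Z) \<noteq> (0 \<in> ?Z))} = {z}"
        unfolding 2 using False by auto
      then show ?thesis unfolding eq using 2 False
        by (simp add: conj_others_zeros at_most_one_zero_def)
    qed
  next
    case 3
    then have "\<not> ?Z \<subseteq> {l}" for l using card_mono[of "{l}" ?Z] by auto
    then show ?thesis using 3 by (simp add: conj_others_zeros at_most_one_zero_def)
  qed
qed

text \<open>The common factor \<open>y\<close> serves both parities of \<open>n\<close>: it is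
  constantly true for odd \<open>n\<close> and the last variable for even \<open>n\<close>.\<close>

lemma realizes_conj_others:
  assumes "odd m" "m \<le> n" "variables n \<subseteq> F" "realizes n c F"
    and U: "(\<lambda>A. at_most_one_zero m A \<and> y A) \<in> F"
  shows "realizes n (c + (m - 1)) ((\<lambda>i A. conj_others m i A \<and> y A) ` {..<m} \<union> F)"
proof -
  have 0: "0 < m" using assms(1) by (rule odd_pos)
  \<comment> \<open>\<open>d i\<close> is the difference of outputs \<open>i\<close> and 0, each
    multiplied by \<open>y\<close>. It costs one conjunction, as the product of
    \<open>at_most_one_zero m\<close> and \<open>y\<close> is already available.\<close>
  define d where "d i A \<longleftrightarrow> (at_most_one_zero m A \<and> y A) \<and> ((i \<in> A) \<noteq> (0 \<in> A))" for i A
  have "realizes n (c + card I) (d ` I \<union> F)" if "finite I" "I \<subseteq> {1..<m}" for I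
    using that
  proof (induction I rule: finite_induct)
    case empty
    then show ?case using assms(4) by simp
  next
    case (insert i I)
    have "realizes n (Suc (c + card I)) (insert (\<lambda>A. (at_most_one_zero m A \<and> y A) \<and>
        ((i \<in> A) \<noteq> (0 \<in> A))) (d ` I \<union> F))"
      using insert assms 0
      by (intro realizes_aspan_and aspan.add variable_in_aspan[where n = n]) (auto intro: aspan.base)
    then show ?case using insert by (simp add: d_def[abs_def])
  qed
  from this[of "{1..<m}"] have R: "realizes n (c + (m - 1)) (d ` {1..<m} \<union> F)" by simp
  let ?S = "aspan (d ` {1..<m} \<union> F)"
  have "(\<lambda>A. (at_most_one_zero m A \<and> y A) \<noteq> odd (card {i \<in> {1..<m}. d i A})) \<in> ?S"
    using U by (intro aspan.add aspan_odd_card) (auto intro: aspan.base)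
  moreover have "(\<lambda>A. (at_most_one_zero m A \<and> y A) \<noteq> odd (card {i \<in> {1..<m}. d i A})) =
      (\<lambda>A. conj_others m 0 A \<and> y A)"
  proof
    fix A
    show "((at_most_one_zero m A \<and> y A) \<noteq> odd (card {i \<in> {1..<m}. d i A})) =
        (conj_others m 0 A \<and> y A)"
      using conj_others_0[OF assms(1), of A] by (cases "y A") (simp_all add: d_def)
  qed
  ultimately have z: "(\<lambda>A. conj_others m 0 A \<and> y A) \<in> ?S" by simp
  have "(\<lambda>A. conj_others m i A \<and> y A) \<in> ?S" if "i < m" for i
  proof (cases "i = 0")
    case False
    then have "(\<lambda>A. d i A \<noteq> (conj_others m 0 A \<and> y A)) \<in> ?S"
      using that by (intro aspan.add z) (auto intro: aspan.base)
    moreover have "(\<lambda>A. d i A \<noteq> (conj_others m 0 A \<and> y A)) = (\<lambda>A. conj_others m i A \<and> y A)"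
      using conj_others_xor[OF that 0] by (auto simp: d_def fun_eq_iff)
    ultimately show ?thesis by simp
  qed (use z in simp)
  then have "realizes n (c + (m - 1))
      ((\<lambda>i A. conj_others m i A \<and> y A) ` {..<m} \<union> (d ` {1..<m} \<union> F))"
    by (intro realizes_aspan_subset[OF _ _ R]) auto
  then show ?thesis by (rule realizes_subset) auto
qed

lemma realizes_all_conj_others:
  assumes "3 \<le> n"
  shows "realizes n (2 * n - 3) (conj_others n ` {..<n})"
proof (cases "odd n")
  case True
  then obtain k where k: "n = 2 * k + 1" by (rule oddE)
  have "realizes n (2 * k - 1) (insert (at_most_one_zero n) (variables n))"
    using realizes_at_most_one_zero[of k n] k assms by simp
  from realizes_conj_others[OF True order_refl _ this, of "\<lambda>_. True"]
  have "realizes n (2 * k - 1 + (n - 1))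
      (conj_others n ` {..<n} \<union> insert (at_most_one_zero n) (variables n))"
    by (simp add: subset_insertI)
  then have "realizes n (2 * k - 1 + (n - 1)) (conj_others n ` {..<n})"
    by (rule realizes_subset[OF _ Un_upper1])
  moreover have "2 * k - 1 + (n - 1) = 2 * n - 3" using k assms by simp
  ultimately show ?thesis by (simp only:)
next
  case False
  define m where "m = n - 1"
  have m: "odd m" "n = Suc m" using False assms unfolding m_def by auto
  obtain k where k: "m = 2 * k + 1" using m(1) by (rule oddE)
  let ?T = "at_most_one_zero m"
  let ?y = "\<lambda>A. m \<in> A"
  let ?P = "\<lambda>A. ?T A \<and> parity m A"
  let ?F = "insert ?P (insert (\<lambda>A. ?T A \<and> ?y A) (insert ?T (variables n)))"
  have "realizes n (2 * k - 1) (insert ?T (variables n))"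
    using realizes_at_most_one_zero[of k n] k m assms by simp
  then have "realizes n (Suc (2 * k - 1)) (insert (\<lambda>A. ?T A \<and> ?y A) (insert ?T (variables n)))"
    using m by (intro realizes_and) (auto simp: variables_def)
  then have "realizes n (Suc (Suc (2 * k - 1))) ?F"
    by (rule realizes_aspan_and) (use m in \<open>auto intro: aspan.base parity_in_aspan[of _ n]\<close>)
  from realizes_conj_others[OF m(1) _ _ this, of ?y]
  have R: "realizes n (Suc (Suc (2 * k - 1)) + (m - 1))
      ((\<lambda>i A. conj_others m i A \<and> ?y A) ` {..<m} \<union> ?F)"
    using m by auto
  \<comment> \<open>The remaining output is the conjunction of the first \<open>m\<close> variables:
    given at most one zero among them, the parity excludes exactly one.\<close>
  have "?P = conj_others n m"
  proof
    fix A
    have *: "conj_others n m A \<longleftrightarrow> card ({..<m} - A) = 0"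
      using m by (auto simp: conj_others_def less_Suc_eq)
    have **: "z \<le> 1 \<and> even z \<longleftrightarrow> z = 0" for z :: nat
      by (cases z) (auto intro: odd_pos)
    show "?P A = conj_others n m A"
      unfolding parity_zeros[OF m(1)] at_most_one_zero_def * ** by (rule refl)
  qed
  moreover have "(\<lambda>A. conj_others m i A \<and> ?y A) = conj_others n i" if "i < m" for i
    using that m by (auto simp: conj_others_def fun_eq_iff less_Suc_eq)
  moreover have "{..<n} = insert m {..<m}" using m by auto
  ultimately have "conj_others n ` {..<n} \<subseteq> (\<lambda>i A. conj_others m i A \<and> ?y A) ` {..<m} \<union> ?F"
    by auto
  with R have "realizes n (Suc (Suc (2 * k - 1)) + (m - 1)) (conj_others n ` {..<n})"
    by (rule realizes_subset)
  \<comment> \<open>The cost is (m - 2) + 2 + (m - 1) = 2m - 1, where m = n - 1.\<close>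
  moreover have "Suc (Suc (2 * k - 1)) + (m - 1) = 2 * n - 3" using k m assms by simp
  ultimately show ?thesis by (simp only:)
qed

theorem theorem1:
  fixes n :: nat
  assumes "n \<ge> 3"
  shows "multiplicative_complexity n
           (\<lambda>xs. map (\<lambda>i. \<forall>j \<in> {..<n} - {i}. xs ! j) [0..<n]) = 2 * n - 3"
  unfolding multiplicative_complexity_def
proof (rule Least_equality)
  let ?f = "\<lambda>xs. map (\<lambda>i. \<forall>j \<in> {..<n} - {i}. xs ! j) [0..<n]"
  have "set (map (conj_others n) [0..<n]) = conj_others n ` {..<n}" by auto
  then have "\<exists>C. computes n C (\<lambda>xs. map (\<lambda>f. f {i. i < n \<and> xs ! i}) (map (conj_others n) [0..<n]))
      \<and> and_count C = 2 * n - 3"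
    using realizes_all_conj_others[OF assms] by (intro ex_computes) (simp only:)
  \<comment> \<open>Only positions below \<open>n\<close> are read, so the two functions agree on
    lists of every length.\<close>
  moreover have "(\<lambda>xs. map (\<lambda>f. f {i. i < n \<and> xs ! i}) (map (conj_others n) [0..<n])) = ?f"
    by (auto simp: conj_others_def fun_eq_iff)
  ultimately show "\<exists>C. computes n C ?f \<and> and_count C = 2 * n - 3" by (simp only:)
next
  let ?f = "\<lambda>xs. map (\<lambda>i. \<forall>j \<in> {..<n} - {i}. xs ! j) [0..<n]"
  fix c assume "\<exists>C. computes n C ?f \<and> and_count C = c"
  then obtain C where "computes n C ?f" "and_count C = c" by (elim exE conjE)
  moreover obtain gs os where "C = Circuit gs os" by (cases C)
  ultimately have C: "computes n (Circuit gs os) ?f" "and_count (Circuit gs os) = c" by simp_all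
  have "wf_circuit n (Circuit gs os)" using C(1) unfolding computes_def by (rule conjunct1)
  then have wf: "wf_circuit n (Circuit gs [])" "set os \<subseteq> {..<n + length gs}"
    unfolding wf_circuit_def by simp_all
  obtain hs where hs: "and_chain (variables n) hs" "length hs = length (filter is_and_gate gs)"
    "wires n gs \<subseteq> aspan (variables n \<union> set hs)" using ex_and_chain[OF wf(1)] by blast
  have eval: "map (\<lambda>a. wire_vals gs (point n A) ! a) os = ?f (point n A)" for A
  proof -
    have len_point: "length (point n A) = n" by (simp add: point_def)
    have "circuit_eval (Circuit gs os) (point n A) = ?f (point n A)"
      using C(1) len_point unfolding computes_def by blast
    then show ?thesis by (simp add: circuit_eval_def)
  qed
  have "conj_others n i \<in> wires n gs" if "i < n" for i
  proof -
    \<comment> \<open>Evaluating at any one point determines the number of outputs, which justifies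
      indexing \<open>os\<close> by \<open>i\<close>.\<close>
    have len: "length os = n" using arg_cong[OF eval[of "{}"], of length] by simp
    have "wire_vals gs (point n A) ! (os ! i) = conj_others n i A" for A
    proof -
      have "map (\<lambda>a. wire_vals gs (point n A) ! a) os ! i = ?f (point n A) ! i"
        by (simp only: eval)
      then show ?thesis using that len by (simp add: conj_others_def point_def)
    qed
    moreover have "os ! i < n + length gs" using wf(2) that len nth_mem by blast
    ultimately show ?thesis unfolding wires_def by (intro image_eqI[of _ _ "os ! i"]) auto
  qed
  then show "2 * n - 3 \<le> c"
    using and_chain_conj_others_length[OF assms hs(1)] hs(2,3) C(2) by (auto simp: and_count_def)
qed

end
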